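(* Let $1<\alpha(\omega)<3$, $0<\beta(\omega)<2$, $0\le\lambda(\omega)<1$, and suppose $m_{\mathrm{eff}}>0$ and $|\zeta_{\mathrm{eff}}|\le1$. The (restricted) free response $x(t)$ to the variable-order fractional vibrator $$m\frac{d^{\alpha(\omega)}x(t)}{dt^{\alpha(\omega)}}+c\frac{d^{\beta(\omega)}x(t)}{dt^{\beta(\omega)}}+k\frac{d^{\lambda(\omega)}x(t)}{dt^{\lambda(\omega)}}=f(t),$$ which is a solution to $$\frac{d^2x(t)}{dt^2}+2\zeta_{\mathrm{eff}}\omega_{\mathrm{effn}}\frac{dx(t)}{dt}+\omega_{\mathrm{effn}}^2x(t)=0,\qquad x(0)=x_0,\ x'(0)=v_0,$$ is given by $$x(t)=e^{-\zeta_{\mathrm{eff}}\omega_{\mathrm{effn}}t}\left(x_0\cos\omega_{\mathrm{effd}}t+\frac{v_0+\zeta_{\mathrm{eff}}\omega_{\mathrm{effn}}x_0}{\omega_{\mathrm{effd}}}\sin\omega_{\mathrm{effd}}t\right),\qquad t\ge0.$$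
   Context: $m$, $c$, $k$ are the constant primary mass, damping coefficient and stiffness, $x(t)$ is the displacement, $f(t)$ is the driving force, $x_0$ and $v_0$ are the initial conditions, and the orders $\alpha,\beta,\lambda$ are functions of the vibration frequency $\omega$. Fractional derivatives are Weyl fractional derivatives, for which the Fourier transform of $x^{(v)}(t)$ is $(i\omega)^vX(\omega)$, where $X(\omega)$ is the Fourier transform of $x(t)$ and $i=\sqrt{-1}$; this rule is also used for variable order $v=v(\omega)$. Define $$m_{\mathrm{eff}}=-\left[m\omega^{\alpha(\omega)-2}\cos\frac{\alpha(\omega)\pi}{2}+c\omega^{\beta(\omega)-2}\cos\frac{\beta(\omega)\pi}{2}\right],$$ $$c_{\mathrm{eff}}=m\omega^{\alpha(\omega)-1}\sin\frac{\alpha(\omega)\pi}{2}+c\omega^{\beta(\omega)-1}\sin\frac{\beta(\omega)\pi}{2}+k\omega^{\lambda(\omega)-1}\sin\frac{\lambda(\omega)\pi}{2},\qquad k_{\mathrm{eff}}=k\omega^{\lambda(\omega)}\cos\frac{\lambda(\omega)\pi}{2},$$ $$\zeta_{\mathrm{eff}}=\frac{c_{\mathrm{eff}}}{2\sqrt{m_{\mathrm{eff}}k_{\mathrm{eff}}}},\qquad\omega_{\mathrm{effn}}=\sqrt{\frac{k_{\mathrm{eff}}}{m_{\mathrm{eff}}}},\qquad\omega_{\mathrm{effd}}=\omega_{\mathrm{effn}}\sqrt{1-\zeta_{\mathrm{eff}}^2}.$$ The vibrator's motion equation is equivalent, in the sense of equality of the Fourier transforms of the left-hand sides (frequency-dependent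 coefficients acting as multipliers in the Fourier domain), to $m_{\mathrm{eff}}x''(t)+c_{\mathrm{eff}}x'(t)+k_{\mathrm{eff}}x(t)=f(t)$, that is, to $x''(t)+2\zeta_{\mathrm{eff}}\omega_{\mathrm{effn}}x'(t)+\omega_{\mathrm{effn}}^2x(t)=f(t)/m_{\mathrm{eff}}$; the free response corresponds to $f=0$. The word "restricted" refers to the conditions $m_{\mathrm{eff}}>0$ and $|\zeta_{\mathrm{eff}}|\le1$.
   Formalization: When |ζ_eff|=1 we have ω_effd=0 and the displayed formula divides by zero; there sin(ω_effd t)/ω_effd is read as its limit t. It is also assumed that ω>0 and k>0, so that the effective parameters are defined. *)

theory Defs
  imports "HOL-Analysis.Analysis"
begin

definition fourier :: "(real \<Rightarrow> real) \<Rightarrow> real \<Rightarrow> complex" where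
  "fourier x \<omega> = (LINT t|lborel. exp (- (\<i> * of_real (\<omega> * t))) * of_real (x t))"

(* The Weyl derivative of variable order v(w) is defined by the Fourier rule
   Y(w) = (i w)^v(w) X(w), with the principal branch of the power.  Only frequencies w > 0 are
   constrained: the signals are real, so the values at w < 0 follow by complex conjugation. *)
definition has_weyl_derivative ::
    "(real \<Rightarrow> real) \<Rightarrow> (real \<Rightarrow> real) \<Rightarrow> (real \<Rightarrow> real) \<Rightarrow> bool" where
  "has_weyl_derivative v x y \<longleftrightarrow>
     integrable lborel x \<and> integrable lborel y \<and>
     (\<forall>\<omega>>0. fourier y \<omega> = (\<i> * of_real \<omega>) powr of_real (v \<omega>) * fourier x \<omega>)"

(* The order of the stiffness term, usually written lambda, is called gamma here because the
   Greek letter lambda is reserved syntax. *)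
definition m_eff :: "real \<Rightarrow> real \<Rightarrow> (real \<Rightarrow> real) \<Rightarrow> (real \<Rightarrow> real) \<Rightarrow> real \<Rightarrow> real" where
  "m_eff m c \<alpha> \<beta> \<omega> =
     - (m * \<omega> powr (\<alpha> \<omega> - 2) * cos (\<alpha> \<omega> * pi / 2) + c * \<omega> powr (\<beta> \<omega> - 2) * cos (\<beta> \<omega> * pi / 2))"

definition c_eff ::
    "real \<Rightarrow> real \<Rightarrow> real \<Rightarrow> (real \<Rightarrow> real) \<Rightarrow> (real \<Rightarrow> real) \<Rightarrow> (real \<Rightarrow> real) \<Rightarrow> real \<Rightarrow> real" where
  "c_eff m c k \<alpha> \<beta> \<gamma> \<omega> =
     m * \<omega> powr (\<alpha> \<omega> - 1) * sin (\<alpha> \<omega> * pi / 2) + c * \<omega> powr (\<beta> \<omega> - 1) * sin (\<beta> \<omega> * pi / 2)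
       + k * \<omega> powr (\<gamma> \<omega> - 1) * sin (\<gamma> \<omega> * pi / 2)"

definition k_eff :: "real \<Rightarrow> (real \<Rightarrow> real) \<Rightarrow> real \<Rightarrow> real" where
  "k_eff k \<gamma> \<omega> = k * \<omega> powr \<gamma> \<omega> * cos (\<gamma> \<omega> * pi / 2)"

definition zeta_eff ::
    "real \<Rightarrow> real \<Rightarrow> real \<Rightarrow> (real \<Rightarrow> real) \<Rightarrow> (real \<Rightarrow> real) \<Rightarrow> (real \<Rightarrow> real) \<Rightarrow> real \<Rightarrow> real" where
  "zeta_eff m c k \<alpha> \<beta> \<gamma> \<omega> = c_eff m c k \<alpha> \<beta> \<gamma> \<omega> / (2 * sqrt (m_eff m c \<alpha> \<beta> \<omega> * k_eff k \<gamma> \<omega>))"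

definition omega_effn ::
    "real \<Rightarrow> real \<Rightarrow> real \<Rightarrow> (real \<Rightarrow> real) \<Rightarrow> (real \<Rightarrow> real) \<Rightarrow> (real \<Rightarrow> real) \<Rightarrow> real \<Rightarrow> real" where
  "omega_effn m c k \<alpha> \<beta> \<gamma> \<omega> = sqrt (k_eff k \<gamma> \<omega> / m_eff m c \<alpha> \<beta> \<omega>)"

definition omega_effd ::
    "real \<Rightarrow> real \<Rightarrow> real \<Rightarrow> (real \<Rightarrow> real) \<Rightarrow> (real \<Rightarrow> real) \<Rightarrow> (real \<Rightarrow> real) \<Rightarrow> real \<Rightarrow> real" where
  "omega_effd m c k \<alpha> \<beta> \<gamma> \<omega> =
     omega_effn m c k \<alpha> \<beta> \<gamma> \<omega> * sqrt (1 - (zeta_eff m c k \<alpha> \<beta> \<gamma> \<omega>)\<^sup>2)"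

(* x solves a x'' + b x' + d x = 0 on [0,oo) with x(0) = x0, x'(0) = v0;
   the derivatives at t = 0 are one-sided. *)
definition solves_free_ivp ::
    "real \<Rightarrow> real \<Rightarrow> real \<Rightarrow> real \<Rightarrow> real \<Rightarrow> (real \<Rightarrow> real) \<Rightarrow> bool" where
  "solves_free_ivp a b d x0 v0 x \<longleftrightarrow>
     (\<exists>x' x''.
        (\<forall>t\<ge>0. (x has_real_derivative x' t) (at t within {0..}) \<and>
               (x' has_real_derivative x'' t) (at t within {0..}) \<and>
               a * x'' t + b * x' t + d * x t = 0) \<and>
        x 0 = x0 \<and> x' 0 = v0)"

(* The closed form with damping ratio z, natural frequency wn and damped frequency wd.  In the
   critically damped case wd = 0 (i.e. |z| = 1), sin (wd t) / wd denotes its limit t, whereas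
   division by zero would yield 0. *)
definition damped_response :: "real \<Rightarrow> real \<Rightarrow> real \<Rightarrow> real \<Rightarrow> real \<Rightarrow> real \<Rightarrow> real" where
  "damped_response z wn wd x0 v0 t =
     exp (- z * wn * t) *
       (x0 * cos (wd * t) +
        (if wd = 0 then (v0 + z * wn * x0) * t
         else (v0 + z * wn * x0) / wd * sin (wd * t)))"

end

theory Submission
  imports Defs
begin

text \<open>
  The statement has two independent halves.

  In the frequency domain, every term of the fractional equation and every term of the equivalent
  second-order equation is a multiple of \<open>X(\<omega>)\<close>. Since the principal power is
  \<open>(\<i>\<omega>)\<^sup>v = \<omega>\<^sup>v (cos (v\<pi>/2) + \<i> sin (v\<pi>/2))\<close> for \<open>\<omega> > 0\<close>, the fractional operator
  has the multiplier
  \<open>m(\<i>\<omega>)\<^sup>\<alpha> + c(\<i>\<omega>)\<^sup>\<beta> + k(\<i>\<omega>)\<^sup>\<gamma>\<close>. The real parts of its inertial and damping terms, divided by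
  \<open>(\<i>\<omega>)\<^sup>2\<close>, make up the effective mass; all the imaginary parts, divided by \<open>\<i>\<omega>\<close>, make up the
  effective damping; the remaining real part is the effective stiffness. The analytic input is
  the classical rule that differentiation becomes multiplication by \<open>\<i>\<omega>\<close>
  (\<open>fourier_derivative\<close>), for a function that is differentiable everywhere and integrable together
  with its derivative.

  In the time domain, \<open>k > 0\<close> and \<open>0 \<le> \<gamma>(\<omega>) < 1\<close> make the effective stiffness positive, so division by
  the effective mass gives the normal form with
  \<open>2\<zeta>\<omega>\<^sub>n = c_eff / m_eff\<close>. As \<open>\<bar>\<zeta>\<bar> \<le> 1\<close>, the
  square root in the damped frequency is real and \<open>\<omega>\<^sub>n\<^sup>2 = (\<zeta>\<omega>\<^sub>n)\<^sup>2 + \<omega>\<^sub>d\<^sup>2\<close>. With \<open>a = \<zeta>\<omega>\<^sub>n\<close>,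
  multiplication of a solution by \<open>exp(at)\<close> removes the damping and leaves
  \<open>u'' + \<omega>\<^sub>d\<^sup>2 u = 0\<close>, whose solutions are spanned by \<open>cos(\<omega>\<^sub>d t)\<close> and \<open>sin(\<omega>\<^sub>d t)/\<omega>\<^sub>d\<close>, the latter
  read as \<open>t\<close> for \<open>\<omega>\<^sub>d = 0\<close>. Uniqueness follows from conservation of the energy
  \<open>u'\<^sup>2 + \<omega>\<^sub>d\<^sup>2 u\<^sup>2\<close> (\<open>free_ivp_trivial\<close>), and it gives the equivalence
  \<open>solves_free_ivp_iff_closed_form\<close>.
\<close>

section \<open>Fourier multipliers of derivatives\<close>

lemma ii_times_powr_of_real:
  fixes w v :: real
  assumes "w > 0"
  shows "(\<i> * of_real w) powr of_real v = of_real (w powr v) * cis (v * pi / 2)"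
proof -
  have "Ln (\<i> * of_real w) = of_real (ln w) + \<i> * of_real (pi / 2)"
    using assms Ln_times_of_real[of w \<i>] by (simp add: mult.commute Ln_of_real)
  then have "(\<i> * of_real w) powr of_real v = exp (of_real (v * ln w)) * exp (\<i> * of_real (v * pi / 2))"
    using assms by (simp add: powr_def exp_add [symmetric] algebra_simps)
  also have "exp (of_real (v * ln w)) = complex_of_real (w powr v)"
    using assms by (simp add: powr_def flip: exp_of_real)
  finally show ?thesis by (simp add: cis_conv_exp)
qed

text \<open>
  A nonzero limit would keep the norm above some \<open>e > 0\<close> on a half-line, whose measure is infinite.
\<close>

lemma integrable_limit_at_top_zero:
  fixes f :: "real \<Rightarrow> 'a::{banach, second_countable_topology}"
  assumes int: "integrable lborel f" and lim: "(f \<longlongrightarrow> l) at_top"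
  shows "l = 0"
proof (rule ccontr)
  assume "l \<noteq> 0"
  define e where "e = norm l / 2"
  have "e > 0" using \<open>l \<noteq> 0\<close> by (simp add: e_def)
  have "((\<lambda>t. norm (f t)) \<longlongrightarrow> norm l) at_top" by (intro tendsto_norm lim)
  moreover have "e < norm l" using \<open>l \<noteq> 0\<close> by (simp add: e_def)
  ultimately have "eventually (\<lambda>t. e < norm (f t)) at_top"
    by (rule order_tendstoD)
  then obtain T where T: "\<And>t. t \<ge> T \<Longrightarrow> e < norm (f t)"
    by (auto simp: eventually_at_top_linorder)
  \<comment> \<open>An interval so long that a function above \<open>e\<close> on it has a larger integral than \<open>norm (f t)\<close> has on the whole line.\<close>
  define n where "n = (LINT t|lborel. norm (f t)) / e + 1"
  have n: "n \<ge> 0" unfolding n_def using \<open>e > 0\<close> by simp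
  have "(LINT t|lborel. e * indicator {T..T + n} t) \<le> (LINT t|lborel. norm (f t))"
  proof (rule integral_mono)
    show "integrable lborel (\<lambda>t. norm (f t))" using int by simp
    show "integrable lborel (\<lambda>t. e * indicator {T..T + n} t)" using n by simp
    show "e * indicator {T..T + n} t \<le> norm (f t)" for t
      using T[of t] by (auto simp: indicator_def)
  qed
  also have "(LINT t|lborel. e * indicator {T..T + n} t) = e * n"
    using n by simp
  also have "e * n = (LINT t|lborel. norm (f t)) + e"
    using \<open>e > 0\<close> by (simp add: n_def distrib_left)
  finally show False using \<open>e > 0\<close> by simp
qed

text \<open>
  The integral of \<open>y'\<close> is the limit of \<open>y r - y (- r)\<close> as \<open>r\<close> grows. That difference is itself
  an integrable function of \<open>r\<close>, so its limit can only be zero. This avoids showing separately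
  that \<open>y\<close> vanishes at both ends. The gauge integral supplies the fundamental theorem of
  calculus for a derivative that need not be continuous.
\<close>

lemma integral_derivative_eq_zero:
  fixes y y' :: "real \<Rightarrow> 'a::euclidean_space"
  assumes deriv: "\<And>t. (y has_vector_derivative y' t) (at t)"
    and int: "integrable lborel y" and int': "integrable lborel y'"
  shows "(LINT t|lborel. y' t) = 0"
proof (rule integrable_limit_at_top_zero)
  show "integrable lborel (\<lambda>t. y t - y (- t))"
    using int lborel_integrable_real_affine[OF int, of "-1" 0] by simp
  have meas [measurable]: "y' \<in> borel_measurable lborel" using int' by simp
  have "((\<lambda>r. LINT t|lborel. indicator {-r..r} t *\<^sub>R y' t) \<longlongrightarrow> (LINT t|lborel. y' t)) at_top"
  proof (rule integral_dominated_convergence_at_top)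
    show "integrable lborel (\<lambda>t. norm (y' t))" using int' by simp
    show "AE t in lborel. ((\<lambda>r. indicator {-r..r} t *\<^sub>R y' t) \<longlongrightarrow> y' t) at_top"
    proof (rule AE_I2)
      fix t :: real
      have "eventually (\<lambda>r. \<bar>t\<bar> \<le> r) at_top" by (rule eventually_ge_at_top)
      then have "eventually (\<lambda>r. indicator {-r..r} t *\<^sub>R y' t = y' t) at_top"
        by eventually_elim (auto simp: indicator_def)
      then show "((\<lambda>r. indicator {-r..r} t *\<^sub>R y' t) \<longlongrightarrow> y' t) at_top"
        by (rule tendsto_eventually)
    qed
    show "\<forall>\<^sub>F r in at_top. AE t in lborel. norm (indicator {-r..r} t *\<^sub>R y' t) \<le> norm (y' t)"
      by (auto simp: indicator_def)
  qed (use meas in measurable)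
  moreover have "eventually (\<lambda>r. (LINT t|lborel. indicator {-r..r} t *\<^sub>R y' t) = y r - y (- r)) at_top"
    using eventually_ge_at_top[of 0]
  proof eventually_elim
    case (elim r)
    have "set_integrable lborel {-r..r} y'"
      unfolding set_integrable_def using integrable_mult_indicator[OF _ int'] by simp
    then have "(LINT t:{-r..r}|lborel. y' t) = integral {-r..r} y'"
      by (rule set_borel_integral_eq_integral)
    also have "\<dots> = y r - y (- r)"
      by (intro integral_unique fundamental_theorem_of_calculus)
         (use elim in \<open>auto intro: has_vector_derivative_at_within deriv\<close>)
    finally show ?case by (simp add: set_lebesgue_integral_def)
  qed
  ultimately show "((\<lambda>r. y r - y (- r)) \<longlongrightarrow> (LINT t|lborel. y' t)) at_top"
    using tendsto_cong by fastforce
qed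

lemma integrable_fourier_kernel:
  assumes "integrable lborel x"
  shows "integrable lborel (\<lambda>t. exp (- (\<i> * of_real (w * t))) * complex_of_real (x t))"
proof (rule Bochner_Integration.integrable_bound)
  show "integrable lborel x" by fact
  have [measurable]: "x \<in> borel_measurable borel" using assms by (simp add: integrable_iff_bounded)
  have "continuous_on UNIV (\<lambda>t. exp (- (\<i> * complex_of_real (w * t))))"
    by (intro continuous_intros)
  from borel_measurable_continuous_onI[OF this]
  show "(\<lambda>t. exp (- (\<i> * of_real (w * t))) * complex_of_real (x t)) \<in> borel_measurable lborel"
    by measurable
  show "AE t in lborel. norm (exp (- (\<i> * of_real (w * t))) * complex_of_real (x t)) \<le> norm (x t)"
    by (simp add: norm_mult)
qed

lemma fourier_add:
  assumes "integrable lborel x" "integrable lborel y"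
  shows "fourier (\<lambda>t. x t + y t) w = fourier x w + fourier y w"
  using integrable_fourier_kernel[OF assms(1), of w] integrable_fourier_kernel[OF assms(2), of w]
  by (simp add: fourier_def distrib_left)

lemma fourier_cmult: "fourier (\<lambda>t. a * x t) w = of_real a * fourier x w"
  by (simp add: fourier_def mult.left_commute)

text \<open>
  The modulated function \<open>y(t) = exp(-\<i>wt) x(t)\<close> has derivative
  \<open>exp(-\<i>wt) (x'(t) - \<i>w x(t))\<close>, whose integral vanishes; this replaces integration by parts.
\<close>

lemma fourier_derivative:
  assumes deriv: "\<And>t. (x has_real_derivative x' t) (at t)"
    and int: "integrable lborel x" and int': "integrable lborel x'"
  shows "fourier x' w = \<i> * of_real w * fourier x w"
proof -
  let ?E = "\<lambda>t. exp (- (\<i> * complex_of_real (w * t)))"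
  have d: "((\<lambda>t. ?E t * of_real (x t)) has_vector_derivative
      ?E t * of_real (x' t) - \<i> * of_real w * (?E t * of_real (x t))) (at t)" for t
  proof -
    have E: "(?E has_vector_derivative - (\<i> * of_real w) * ?E t) (at t)"
    proof -
      have "((\<lambda>z. exp (- (\<i> * of_real w) * z)) has_field_derivative
          - (\<i> * of_real w) * exp (- (\<i> * of_real w) * of_real t)) (at (of_real t))"
        by (auto intro!: derivative_eq_intros)
      from has_vector_derivative_real_field[OF this] show ?thesis by (simp add: o_def mult.assoc)
    qed
    have X: "((\<lambda>t. complex_of_real (x t)) has_vector_derivative of_real (x' t)) (at t)"
      by (intro has_vector_derivative_of_real) (simp add: deriv has_real_derivative_iff_has_vector_derivative [symmetric])
    show ?thesis
      using has_vector_derivative_mult[OF E X] by (simp add: algebra_simps)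
  qed
  have i: "integrable lborel (\<lambda>t. ?E t * of_real (x t))" "integrable lborel (\<lambda>t. ?E t * of_real (x' t))"
    by (rule integrable_fourier_kernel[OF int], rule integrable_fourier_kernel[OF int'])
  have "0 = (LINT t|lborel. ?E t * of_real (x' t) - \<i> * of_real w * (?E t * of_real (x t)))"
    by (rule integral_derivative_eq_zero[OF d, symmetric]) (use i in auto)
  also have "\<dots> = fourier x' w - \<i> * of_real w * fourier x w"
    using i by (simp add: fourier_def)
  finally show ?thesis by simp
qed

text \<open>
  Both sides are multiples of the transform of \<open>x\<close>, so the claim is an identity between two
  multipliers, checked on real and imaginary parts.
\<close>

lemma fourier_fractional_operator:
  assumes "w > 0"
    and "\<And>t. (x has_real_derivative x' t) (at t)" "\<And>t. (x' has_real_derivative x'' t) (at t)"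
    and "integrable lborel x" "integrable lborel x'" "integrable lborel x''"
    and weyl: "has_weyl_derivative \<alpha> x xa" "has_weyl_derivative \<beta> x xb" "has_weyl_derivative \<gamma> x xl"
  shows "fourier (\<lambda>t. m * xa t + c * xb t + k * xl t) w =
    of_real (m_eff m c \<alpha> \<beta> w) * fourier x'' w
    + of_real (c_eff m c k \<alpha> \<beta> \<gamma> w) * fourier x' w
    + of_real (k_eff k \<gamma> w) * fourier x w"
proof -
  let ?X = "fourier x w"
  have X': "fourier x' w = \<i> * of_real w * ?X"
    by (rule fourier_derivative) fact+
  have X'': "fourier x'' w = \<i> * of_real w * (\<i> * of_real w * ?X)"
    unfolding X' [symmetric] by (rule fourier_derivative) fact+
  have int: "integrable lborel xa" "integrable lborel xb" "integrable lborel xl"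
    using weyl by (auto simp: has_weyl_derivative_def)
  have F: "fourier xa w = of_real (w powr \<alpha> w) * cis (\<alpha> w * pi / 2) * ?X"
    "fourier xb w = of_real (w powr \<beta> w) * cis (\<beta> w * pi / 2) * ?X"
    "fourier xl w = of_real (w powr \<gamma> w) * cis (\<gamma> w * pi / 2) * ?X"
    using weyl \<open>w > 0\<close> by (simp_all add: has_weyl_derivative_def ii_times_powr_of_real)
  have p1: "w powr (v - 1) * w = w powr v" and p2: "w powr (v - 2) * w\<^sup>2 = w powr v" for v
    using \<open>w > 0\<close> by (simp_all add: powr_diff)
  have m: "m_eff m c \<alpha> \<beta> w * w\<^sup>2 =
      - (m * w powr \<alpha> w * cos (\<alpha> w * pi / 2) + c * w powr \<beta> w * cos (\<beta> w * pi / 2))"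
  proof -
    have "m_eff m c \<alpha> \<beta> w * w\<^sup>2 =
        - (m * (w powr (\<alpha> w - 2) * w\<^sup>2) * cos (\<alpha> w * pi / 2)
           + c * (w powr (\<beta> w - 2) * w\<^sup>2) * cos (\<beta> w * pi / 2))"
      by (simp add: m_eff_def algebra_simps)
    then show ?thesis by (simp only: p2)
  qed
  have c: "c_eff m c k \<alpha> \<beta> \<gamma> w * w =
      m * w powr \<alpha> w * sin (\<alpha> w * pi / 2) + c * w powr \<beta> w * sin (\<beta> w * pi / 2)
      + k * w powr \<gamma> w * sin (\<gamma> w * pi / 2)"
  proof -
    have "c_eff m c k \<alpha> \<beta> \<gamma> w * w =
        m * (w powr (\<alpha> w - 1) * w) * sin (\<alpha> w * pi / 2)
        + c * (w powr (\<beta> w - 1) * w) * sin (\<beta> w * pi / 2)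
        + k * (w powr (\<gamma> w - 1) * w) * sin (\<gamma> w * pi / 2)"
      by (simp add: c_eff_def algebra_simps)
    then show ?thesis by (simp only: p1)
  qed
  have symbol: "of_real m * (of_real (w powr \<alpha> w) * cis (\<alpha> w * pi / 2))
      + of_real c * (of_real (w powr \<beta> w) * cis (\<beta> w * pi / 2))
      + of_real k * (of_real (w powr \<gamma> w) * cis (\<gamma> w * pi / 2))
    = - of_real (m_eff m c \<alpha> \<beta> w * w\<^sup>2) + \<i> * of_real (c_eff m c k \<alpha> \<beta> \<gamma> w * w)
      + of_real (k_eff k \<gamma> w)"
    unfolding m c by (simp add: complex_eq_iff k_eff_def)
  have "fourier (\<lambda>t. m * xa t + c * xb t + k * xl t) w =
      of_real m * fourier xa w + of_real c * fourier xb w + of_real k * fourier xl w"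
    using int by (simp add: fourier_add fourier_cmult)
  also have "\<dots> = (of_real m * (of_real (w powr \<alpha> w) * cis (\<alpha> w * pi / 2))
      + of_real c * (of_real (w powr \<beta> w) * cis (\<beta> w * pi / 2))
      + of_real k * (of_real (w powr \<gamma> w) * cis (\<gamma> w * pi / 2))) * ?X"
    unfolding F by (simp add: algebra_simps)
  also have "\<dots> = of_real (m_eff m c \<alpha> \<beta> w) * fourier x'' w
    + of_real (c_eff m c k \<alpha> \<beta> \<gamma> w) * fourier x' w + of_real (k_eff k \<gamma> w) * ?X"
    unfolding symbol X'' X' by (simp add: algebra_simps power2_eq_square)
  finally show ?thesis .
qed

section \<open>The free damped oscillator\<close>

text \<open>
  This is the solution of \<open>s'' + d\<^sup>2 s = 0\<close> with \<open>s(0) = 0\<close> and \<open>s'(0) = 1\<close>; including the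
  degenerate value \<open>d = 0\<close> lets underdamped and critically damped motion share one proof.
\<close>

definition scaled_sine :: "real \<Rightarrow> real \<Rightarrow> real" where
  "scaled_sine d t = (if d = 0 then t else sin (d * t) / d)"

lemma scaled_sine_0 [simp]: "scaled_sine d 0 = 0"
  by (simp add: scaled_sine_def)

lemma scaled_sine_derivative [derivative_intros]:
  "(scaled_sine d has_real_derivative cos (d * t)) (at t within S)"
proof (cases "d = 0")
  case True
  then have "scaled_sine d = (\<lambda>t. t)" by (auto simp: scaled_sine_def)
  with True show ?thesis by (auto intro!: derivative_eq_intros)
next
  case False
  then have "scaled_sine d = (\<lambda>t. sin (d * t) / d)" by (auto simp: scaled_sine_def)
  with False show ?thesis by (auto intro!: derivative_eq_intros)
qed

lemma cos_derivative_scaled_sine: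
  "((\<lambda>t. cos (d * t)) has_real_derivative - d\<^sup>2 * scaled_sine d t) (at t within S)"
  by (auto intro!: derivative_eq_intros simp: scaled_sine_def power2_eq_square)

lemma constant_on_nonneg:
  fixes f :: "real \<Rightarrow> real"
  assumes "\<And>t. t \<ge> 0 \<Longrightarrow> (f has_real_derivative 0) (at t within {0..})" "t \<ge> 0"
  shows "f t = f 0"
proof -
  have "\<exists>c. \<forall>t\<in>{0..}. f t = c"
    by (rule has_field_derivative_zero_constant) (use assms in auto)
  with \<open>t \<ge> 0\<close> show ?thesis by auto
qed

text \<open>
  For \<open>u(t) = exp(at) x(t)\<close> the equation becomes \<open>u'' = -d\<^sup>2 u\<close>, so the energy \<open>u'\<^sup>2 + d\<^sup>2 u\<^sup>2\<close> is
  constant, hence zero. If \<open>d = 0\<close> the energy does not control \<open>u\<close>, but it always forces \<open>u' = 0\<close>,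
  and with \<open>u(0) = 0\<close> this suffices.
\<close>

lemma free_ivp_trivial:
  assumes ivp: "solves_free_ivp 1 (2 * a) (a\<^sup>2 + d\<^sup>2) 0 0 x" and t: "t \<ge> 0"
  shows "x t = 0"
proof -
  from ivp obtain x' x'' where
    x': "\<And>t. t \<ge> 0 \<Longrightarrow> (x has_real_derivative x' t) (at t within {0..})" and
    x'': "\<And>t. t \<ge> 0 \<Longrightarrow> (x' has_real_derivative x'' t) (at t within {0..})" and
    eq: "\<And>t. t \<ge> 0 \<Longrightarrow> x'' t = - 2 * a * x' t - (a\<^sup>2 + d\<^sup>2) * x t" and
    init: "x 0 = 0" "x' 0 = 0"
    unfolding solves_free_ivp_def by (fastforce simp: algebra_simps)
  define u where "u t = exp (a * t) * x t" for t
  define u' where "u' t = exp (a * t) * (x' t + a * x t)" for t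
  have u: "(u has_real_derivative u' t) (at t within {0..})" if "t \<ge> 0" for t
    unfolding u_def u'_def
    by (rule derivative_eq_intros x'[OF that] refl | simp add: algebra_simps)+
  have u': "(u' has_real_derivative - d\<^sup>2 * u t) (at t within {0..})" if "t \<ge> 0" for t
    unfolding u_def u'_def
    by (rule derivative_eq_intros x'[OF that] x''[OF that] refl
      | simp add: eq[OF that] algebra_simps power2_eq_square)+
  have energy: "(u' t)\<^sup>2 + d\<^sup>2 * (u t)\<^sup>2 = 0" if "t \<ge> 0" for t
  proof -
    have "(u' t)\<^sup>2 + d\<^sup>2 * (u t)\<^sup>2 = (u' 0)\<^sup>2 + d\<^sup>2 * (u 0)\<^sup>2"
    proof (rule constant_on_nonneg[OF _ that])
      fix s :: real assume "s \<ge> 0"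
      show "((\<lambda>t. (u' t)\<^sup>2 + d\<^sup>2 * (u t)\<^sup>2) has_real_derivative 0) (at s within {0..})"
        by (rule derivative_eq_intros u[OF \<open>s \<ge> 0\<close>] u'[OF \<open>s \<ge> 0\<close>] refl | simp)+
    qed
    then show ?thesis by (simp add: u_def u'_def init)
  qed
  have "u' t = 0" if "t \<ge> 0" for t
    using energy[OF that] by (simp add: add_nonneg_eq_0_iff)
  then have "u t = u 0"
    using u constant_on_nonneg[OF _ t, of u] by force
  then show ?thesis by (simp add: u_def init)
qed

lemma solves_free_ivp_diff:
  assumes "solves_free_ivp a b d x0 v0 x" "solves_free_ivp a b d x1 v1 y"
  shows "solves_free_ivp a b d (x0 - x1) (v0 - v1) (\<lambda>t. x t - y t)"
proof -
  from assms(1) obtain x' x'' where x: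
    "\<And>t. t \<ge> 0 \<Longrightarrow> (x has_real_derivative x' t) (at t within {0..})"
    "\<And>t. t \<ge> 0 \<Longrightarrow> (x' has_real_derivative x'' t) (at t within {0..})"
    "\<And>t. t \<ge> 0 \<Longrightarrow> a * x'' t + b * x' t + d * x t = 0" "x 0 = x0" "x' 0 = v0"
    unfolding solves_free_ivp_def by auto
  from assms(2) obtain y' y'' where y:
    "\<And>t. t \<ge> 0 \<Longrightarrow> (y has_real_derivative y' t) (at t within {0..})"
    "\<And>t. t \<ge> 0 \<Longrightarrow> (y' has_real_derivative y'' t) (at t within {0..})"
    "\<And>t. t \<ge> 0 \<Longrightarrow> a * y'' t + b * y' t + d * y t = 0" "y 0 = x1" "y' 0 = v1"
    unfolding solves_free_ivp_def by auto
  have "a * (x'' t - y'' t) + b * (x' t - y' t) + d * (x t - y t) = 0" if "t \<ge> 0" for t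
    using x(3)[OF that] y(3)[OF that] by (simp add: algebra_simps)
  with x y show ?thesis
    unfolding solves_free_ivp_def
    by (intro exI[of _ "\<lambda>t. x' t - y' t"] exI[of _ "\<lambda>t. x'' t - y'' t"])
       (auto intro: DERIV_diff)
qed

text \<open>
  The derivatives are taken within the half-line, so even at \<open>t = 0\<close> the values at negative times do
  not matter.
\<close>

lemma solves_free_ivp_cong:
  assumes "\<And>t. t \<ge> 0 \<Longrightarrow> x t = y t"
  shows "solves_free_ivp a b d x0 v0 x \<longleftrightarrow> solves_free_ivp a b d x0 v0 y"
proof -
  have "(x has_real_derivative z) (at t within {0..}) \<longleftrightarrow> (y has_real_derivative z) (at t within {0..})"
    if "t \<ge> 0" for t z
    by (rule has_field_derivative_cong_eventually)
       (use assms that in \<open>auto simp: eventually_at_filter\<close>)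
  with assms show ?thesis unfolding solves_free_ivp_def by auto
qed

lemma free_ivp_closed_form_solves:
  "solves_free_ivp 1 (2 * a) (a\<^sup>2 + d\<^sup>2) x0 v0
     (\<lambda>t. exp (- a * t) * (x0 * cos (d * t) + (v0 + a * x0) * scaled_sine d t))"
proof -
  let ?C = "\<lambda>t. cos (d * t)" and ?S = "scaled_sine d"
  \<comment> \<open>Differentiation preserves the span of the two damped modes, so the coefficient map applied
    twice gives the second derivative.\<close>
  have D: "((\<lambda>t. exp (- a * t) * (p * ?C t + q * ?S t)) has_real_derivative
      exp (- a * t) * ((q - a * p) * ?C t + (- d\<^sup>2 * p - a * q) * ?S t)) (at t within {0..})" for p q t
    by (rule derivative_eq_intros cos_derivative_scaled_sine refl | simp add: algebra_simps)+
  show ?thesis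
    unfolding solves_free_ivp_def
    by (rule exI, rule exI, intro conjI allI impI, rule D, rule D)
       (simp_all add: algebra_simps power2_eq_square)
qed

lemma solves_free_ivp_iff_closed_form:
  "solves_free_ivp 1 (2 * a) (a\<^sup>2 + d\<^sup>2) x0 v0 x \<longleftrightarrow>
    (\<forall>t\<ge>0. x t = exp (- a * t) * (x0 * cos (d * t) + (v0 + a * x0) * scaled_sine d t))"
    (is "?ivp x \<longleftrightarrow> (\<forall>t\<ge>0. x t = ?y t)")
proof
  assume "?ivp x"
  from solves_free_ivp_diff[OF this free_ivp_closed_form_solves[of a d x0 v0]]
  have "solves_free_ivp 1 (2 * a) (a\<^sup>2 + d\<^sup>2) 0 0 (\<lambda>t. x t - ?y t)"
    by simp
  from free_ivp_trivial[OF this] show "\<forall>t\<ge>0. x t = ?y t" by simp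
next
  assume "\<forall>t\<ge>0. x t = ?y t"
  then show "?ivp x"
    using solves_free_ivp_cong[of x ?y] free_ivp_closed_form_solves by blast
qed

lemma damped_response_eq:
  "damped_response z n d x0 v0 t =
    exp (- (z * n) * t) * (x0 * cos (d * t) + (v0 + (z * n) * x0) * scaled_sine d t)"
  by (simp add: damped_response_def scaled_sine_def)

lemma solves_free_ivp_scale:
  assumes "s \<noteq> 0"
  shows "solves_free_ivp (s * a) (s * b) (s * d) x0 v0 x \<longleftrightarrow> solves_free_ivp a b d x0 v0 x"
proof -
  have "s * a * p + s * b * q + s * d * r = s * (a * p + b * q + d * r)" for p q r
    by (simp add: algebra_simps)
  with assms show ?thesis by (simp add: solves_free_ivp_def)
qed

section \<open>The variable-order fractional vibrator\<close>

theorem theorem5p1: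
  fixes m c k \<omega> x0 v0 :: real and \<alpha> \<beta> \<gamma> :: "real \<Rightarrow> real"
  assumes "\<omega> > 0" and "k > 0"
    and "1 < \<alpha> \<omega>" "\<alpha> \<omega> < 3"
    and "0 < \<beta> \<omega>" "\<beta> \<omega> < 2"
    and "0 \<le> \<gamma> \<omega>" "\<gamma> \<omega> < 1"
    and "m_eff m c \<alpha> \<beta> \<omega> > 0"
    and "\<bar>zeta_eff m c k \<alpha> \<beta> \<gamma> \<omega>\<bar> \<le> 1"
  shows
    "(\<forall>x x' x'' xa xb xl.
        (\<forall>t. (x has_real_derivative x' t) (at t) \<and> (x' has_real_derivative x'' t) (at t)) \<longrightarrow>
        integrable lborel x \<longrightarrow> integrable lborel x' \<longrightarrow> integrable lborel x'' \<longrightarrow>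
        has_weyl_derivative \<alpha> x xa \<longrightarrow> has_weyl_derivative \<beta> x xb \<longrightarrow>
        has_weyl_derivative \<gamma> x xl \<longrightarrow>
        fourier (\<lambda>t. m * xa t + c * xb t + k * xl t) \<omega> =
          of_real (m_eff m c \<alpha> \<beta> \<omega>) * fourier x'' \<omega>
          + of_real (c_eff m c k \<alpha> \<beta> \<gamma> \<omega>) * fourier x' \<omega>
          + of_real (k_eff k \<gamma> \<omega>) * fourier x \<omega>)
     \<and> (\<forall>x.
          (solves_free_ivp (m_eff m c \<alpha> \<beta> \<omega>) (c_eff m c k \<alpha> \<beta> \<gamma> \<omega>) (k_eff k \<gamma> \<omega>) x0 v0 x \<longleftrightarrow>
           solves_free_ivp 1
             (2 * zeta_eff m c k \<alpha> \<beta> \<gamma> \<omega> * omega_effn m c k \<alpha> \<beta> \<gamma> \<omega>)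
             ((omega_effn m c k \<alpha> \<beta> \<gamma> \<omega>)\<^sup>2) x0 v0 x)
        \<and> (solves_free_ivp 1
             (2 * zeta_eff m c k \<alpha> \<beta> \<gamma> \<omega> * omega_effn m c k \<alpha> \<beta> \<gamma> \<omega>)
             ((omega_effn m c k \<alpha> \<beta> \<gamma> \<omega>)\<^sup>2) x0 v0 x \<longleftrightarrow>
           (\<forall>t\<ge>0. x t = damped_response (zeta_eff m c k \<alpha> \<beta> \<gamma> \<omega>) (omega_effn m c k \<alpha> \<beta> \<gamma> \<omega>)
                          (omega_effd m c k \<alpha> \<beta> \<gamma> \<omega>) x0 v0 t)))"
proof -
  let ?m = "m_eff m c \<alpha> \<beta> \<omega>" and ?c = "c_eff m c k \<alpha> \<beta> \<gamma> \<omega>" and ?k = "k_eff k \<gamma> \<omega>"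
  let ?z = "zeta_eff m c k \<alpha> \<beta> \<gamma> \<omega>" and ?n = "omega_effn m c k \<alpha> \<beta> \<gamma> \<omega>"
    and ?d = "omega_effd m c k \<alpha> \<beta> \<gamma> \<omega>"
  have "0 \<le> \<gamma> \<omega> * pi / 2" "\<gamma> \<omega> * pi / 2 < pi / 2"
    using \<open>0 \<le> \<gamma> \<omega>\<close> \<open>\<gamma> \<omega> < 1\<close> by simp_all
  then have "cos (\<gamma> \<omega> * pi / 2) > 0"
    by (intro cos_gt_zero_pi) (use pi_gt_zero in linarith)+
  then have "?k > 0"
    using \<open>k > 0\<close> \<open>\<omega> > 0\<close> by (simp add: k_eff_def)
  have n2: "?n\<^sup>2 = ?k / ?m"
    using \<open>?k > 0\<close> \<open>?m > 0\<close> by (simp add: omega_effn_def)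
  have zn: "2 * ?z * ?n = ?c / ?m"
  proof -
    have "2 * ?z * ?n = ?c * (sqrt (?k / ?m) / sqrt (?m * ?k))"
      by (simp add: zeta_eff_def omega_effn_def)
    also have "sqrt (?k / ?m) / sqrt (?m * ?k) = sqrt ((1 / ?m)\<^sup>2)"
      unfolding real_sqrt_divide [symmetric]
      using \<open>?k > 0\<close> by (simp add: power2_eq_square)
    finally show ?thesis using \<open>?m > 0\<close> by simp
  qed
  have "?z\<^sup>2 \<le> 1" using \<open>\<bar>?z\<bar> \<le> 1\<close> by (simp add: abs_square_le_1)
  then have n2_split: "?n\<^sup>2 = (?z * ?n)\<^sup>2 + ?d\<^sup>2"
    by (simp add: omega_effd_def power_mult_distrib algebra_simps)
  have "solves_free_ivp ?m ?c ?k x0 v0 x \<longleftrightarrow> solves_free_ivp 1 (2 * ?z * ?n) (?n\<^sup>2) x0 v0 x" for x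
    using solves_free_ivp_scale[of ?m 1 "?c / ?m" "?k / ?m"] \<open>?m > 0\<close> by (simp add: zn n2)
  moreover have "solves_free_ivp 1 (2 * ?z * ?n) (?n\<^sup>2) x0 v0 x \<longleftrightarrow>
      (\<forall>t\<ge>0. x t = damped_response ?z ?n ?d x0 v0 t)" for x
    unfolding damped_response_eq n2_split mult.assoc[of 2] by (rule solves_free_ivp_iff_closed_form)
  ultimately show ?thesis
    using fourier_fractional_operator[OF \<open>\<omega> > 0\<close>] by blast
qed

end
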